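(* Let $\mathcal X$ be a complete separable metric space, let $\{\mathcal B_k\}_{k\ge1}$ be an increasing sequence of finite subfields that asymptotically generate the Borel $\sigma$-field of $\mathcal X$, and let $\{\ell_k\}_{k\ge1}$, $\{J_k\}_{k\ge1}$ be nondecreasing unbounded sequences of positive integers. Let $\{X_t\}_{t\in\mathbb Z}$ be a stationary process with values in $\mathcal X$ and distribution $P$, and let $\hat P_k(dx\mid X^{-\lambda_k})$ be the empirical conditional distributions defined in the context. Then for every set $B\in\bigcup_k\mathcal B_k$, $$\lim_{k\to\infty}\hat P_k\{X_0\in B\mid X^{-\lambda_k}\}=P\{X_0\in B\mid X^-\}\quad\text{in } L^1(P).$$
   Context: Notation: $X=X_0$; $X^-=(\ldots,X_{-2},X_{-1})$ is the infinite past; $X^{-t}=(X_{-t},\ldots,X_{-1})$ for $t\ge 1$. "Asymptotically generate" means that $\sigma\big(\bigcup_k\mathcal B_k\big)$ is the Borel $\sigma$-field of $\mathcal X$. For $x\in\mathcal X$, $[x]^k$ denotes the atom of the finite field $\mathcal B_k$ that contains $x$. Past recurrence times: for $k\ge1$ put $\tau^k_0=0$ and, for $j=1,2,\ldots$, $$\tau^k_j=\min\{t>\tau^k_{j-1}:\ ([X_{-\ell_k-t}]^k,\ldots,[X_{-1-t}]^k)=([X_{-\ell_k}]^k,\ldots,[X_{-1}]^k)\}.$$ These are finite almost surely by Poincaré's recurrence theorem. Put $\lambda_k=\ell_k+\tau^k_{J_k}$ and $$\hat P_k(dx\mid X^{-\lambda_k})=\frac1{J_k}\sum_{1\le j\le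 J_k}\delta_{X_{-\tau^k_j}}(dx),$$ where $\delta_\xi$ is the unit point mass at $\xi$; thus $\hat P_k\{X_0\in B\mid X^{-\lambda_k}\}=\frac1{J_k}\sum_{1\le j\le J_k}1\{X_{-\tau^k_j}\in B\}$. *)

theory Defs
  imports "HOL-Probability.Probability"
begin

text \<open>A \<^emph>\<open>field\<close> of subsets of the state space is an \<^const>\<open>algebra\<close> on \<^term>\<open>UNIV\<close>.
  In a finite field the atom containing \<open>x\<close> is the intersection of all members containing \<open>x\<close>;
  \<open>atom_of_unique\<close> below confirms that it is the unique minimal nonempty member containing \<open>x\<close>.\<close>

definition atom_of :: "'a set set \<Rightarrow> 'a \<Rightarrow> 'a set" where
  "atom_of \<A> x = \<Inter>{A \<in> \<A>. x \<in> A}"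

lemma atom_of_in:
  assumes "algebra UNIV \<A>" "finite \<A>"
  shows "atom_of \<A> x \<in> \<A>" "x \<in> atom_of \<A> x"
proof -
  interpret algebra UNIV \<A> by fact
  have "\<Inter>{A \<in> \<A>. x \<in> A} \<in> \<A>"
    by (rule finite_INT[of _ "\<lambda>A. A", simplified]) (use assms(2) top in auto)
  then show "atom_of \<A> x \<in> \<A>" by (simp add: atom_of_def)
  show "x \<in> atom_of \<A> x" by (simp add: atom_of_def)
qed

lemma atom_of_unique:
  assumes "algebra UNIV \<A>" "finite \<A>"
  shows "A = atom_of \<A> x \<longleftrightarrow> A \<in> \<A> \<and> x \<in> A \<and> (\<forall>C\<in>\<A>. C \<noteq> {} \<longrightarrow> C \<subseteq> A \<longrightarrow> C = A)"
proof -
  interpret algebra UNIV \<A> by fact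
  have min: "C = atom_of \<A> x" if C: "C \<in> \<A>" "C \<noteq> {}" "C \<subseteq> atom_of \<A> x" for C
  proof (cases "x \<in> C")
    case True
    with C show ?thesis by (auto simp: atom_of_def)
  next
    case False
    have "UNIV - C \<in> \<A>" using C by auto
    with False have "atom_of \<A> x \<subseteq> UNIV - C" by (auto simp: atom_of_def)
    with C show ?thesis by blast
  qed
  have "atom_of \<A> x \<subseteq> A" if "A \<in> \<A>" "x \<in> A"
    using that by (auto simp: atom_of_def)
  with min atom_of_in[OF assms, of x] show ?thesis by blast
qed

text \<open>For a path \<open>x\<close>, \<open>recurrence_time \<A> l x j\<close> is the \<open>j\<close>-th past recurrence time of the
  quantised block of length \<open>l\<close>. Where no recurrence exists (a null event, by Poincare recurrence)
  \<open>LEAST\<close> returns an unspecified number.\<close>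

primrec recurrence_time :: "'a set set \<Rightarrow> nat \<Rightarrow> (int \<Rightarrow> 'a) \<Rightarrow> nat \<Rightarrow> nat" where
  "recurrence_time \<A> l x 0 = 0"
| "recurrence_time \<A> l x (Suc j) =
     (LEAST t. recurrence_time \<A> l x j < t \<and>
        (\<forall>i\<in>{1..l}. atom_of \<A> (x (- int i - int t)) = atom_of \<A> (x (- int i))))"

text \<open>The image of the uniform distribution on \<open>{1..n}\<close>, i.e. the average of the point masses at
  the values that followed the first \<open>n\<close> recurrences. It looks at the path only at times
  \<open>- (l + recurrence_time \<A> l x n), \<dots>, -1\<close>.\<close>

definition empirical_cond_dist ::
    "'a::topological_space set set \<Rightarrow> nat \<Rightarrow> nat \<Rightarrow> (int \<Rightarrow> 'a) \<Rightarrow> 'a measure" where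
  "empirical_cond_dist \<A> l n x =
     distr (uniform_count_measure {1..n}) borel (\<lambda>j. x (- int (recurrence_time \<A> l x j)))"

lemma measure_empirical_cond_dist:
  assumes "B \<in> sets borel" "0 < n"
  shows "measure (empirical_cond_dist \<A> l n x) B =
    (1 / real n) * (\<Sum>j=1..n. indicator B (x (- int (recurrence_time \<A> l x j))))"
proof -
  let ?f = "\<lambda>j. x (- int (recurrence_time \<A> l x j))"
  have "measure (empirical_cond_dist \<A> l n x) B =
      measure (uniform_count_measure {1..n}) (?f -` B \<inter> {1..n})"
    unfolding empirical_cond_dist_def using assms(1)
    by (subst measure_distr) (auto simp: space_uniform_count_measure sets_uniform_count_measure
        measurable_def)
  also have "\<dots> = real (card (?f -` B \<inter> {1..n})) / real n"
    by (subst measure_uniform_count_measure) auto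
  also have "real (card (?f -` B \<inter> {1..n})) = (\<Sum>j=1..n. indicator B (?f j))"
    by (simp add: indicator_def sum.If_cases vimage_def Int_commute)
  finally show ?thesis by simp
qed

definition stationary_process :: "'w measure \<Rightarrow> (int \<Rightarrow> 'w \<Rightarrow> 'a::topological_space) \<Rightarrow> bool" where
  "stationary_process M X \<longleftrightarrow>
     (\<forall>t. X t \<in> borel_measurable M) \<and>
     (\<forall>s. distr M (\<Pi>\<^sub>M t\<in>UNIV. borel) (\<lambda>\<omega> t. X (t + s) \<omega>) =
          distr M (\<Pi>\<^sub>M t\<in>UNIV. borel) (\<lambda>\<omega> t. X t \<omega>))"

definition past_field :: "'w measure \<Rightarrow> (int \<Rightarrow> 'w \<Rightarrow> 'a::topological_space) \<Rightarrow> 'w measure" where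
  "past_field M X =
     vimage_algebra (space M) (\<lambda>\<omega>. \<lambda>t\<in>{..<0}. X t \<omega>) (\<Pi>\<^sub>M t\<in>{..<0}. borel)"

text \<open>Integrability is demanded explicitly because the Bochner integral of a
  nonintegrable function is \<open>0\<close>.\<close>

definition converges_in_L1 :: "'w measure \<Rightarrow> (nat \<Rightarrow> 'w \<Rightarrow> real) \<Rightarrow> ('w \<Rightarrow> real) \<Rightarrow> bool" where
  "converges_in_L1 M f g \<longleftrightarrow>
     (\<forall>k\<ge>1. integrable M (f k)) \<and> integrable M g \<and>
     (\<lambda>k. \<integral>\<omega>. \<bar>f k \<omega> - g \<omega>\<bar> \<partial>M) \<longlonglongrightarrow> 0"

end

theory Submission
  imports Defs "HOL-Real_Asymp.Real_Asymp"
begin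

text \<open>
  On the path space with the law \<open>Q\<close> of the process, let \<open>T\<close> be the time shift and \<open>q\<close> the quantised
  block of length \<open>l\<close> before time \<open>0\<close>. Shifting a path back to its first recurrence time is a map \<open>S\<close>,
  the induced map of the shift on each cell of \<open>q\<close>, and its \<open>j\<close>-th iterate shifts back to the \<open>j\<close>-th
  recurrence time. By Poincare recurrence almost every path returns, and time reversal of
  return times makes \<open>S\<close> preserve \<open>Q\<close> (\<open>S_preserving\<close>).

  Let \<open>f x\<close> indicate that \<open>x 0 \<in> B\<close>, let \<open>g\<close> be its conditional expectation given the past, and
  \<open>d = f - g\<close>. The empirical conditional probability is the average of \<open>f\<close> over the first \<open>n\<close> iterates
  of \<open>S\<close>. Along this orbit \<open>d\<close> is a reversed sequence of martingale differences: \<open>d\<close> is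
  orthogonal to functions of the past, and everything observed at earlier times of the process
  (later points of the orbit) is such a function. Hence the average of \<open>d\<close> has \<open>L\<^sup>2\<close> norm of order
  \<open>1 / sqrt n\<close> (\<open>integral_square_orbit_sum\<close>), whatever the block length is.

  The average of \<open>g\<close> along the orbit is compared with \<open>g\<close> directly. If \<open>h\<close> depends on the
  path through \<open>q\<close> only, then \<open>h\<close> is constant along the orbit, so by invariance of \<open>Q\<close> the average
  of \<open>g\<close> differs from \<open>g\<close> in \<open>L\<^sup>1\<close> by at most twice the distance from \<open>g\<close> to \<open>h\<close>. Together this is
  the bound \<open>recurrence_average_L1_bound\<close>. Since the quantised blocks generate the past, such \<open>h\<close> come
  arbitrarily close to \<open>g\<close> (\<open>cell_approximable_integrable\<close>), and because the blocks refine each other,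
  an \<open>h\<close> that serves for one \<open>k\<close> serves for all larger \<open>k\<close>. As \<open>n = J k\<close> tends to infinity, the
  bound becomes arbitrarily small.
\<close>

section \<open>Backward returns under a stationary flow\<close>

text \<open>\<open>F\<close> plays the part of the strict past and \<open>q\<close> that of the quantised recent past. A function \<open>h\<close>
  of the past and the present is one for which \<open>h\<close> composed with \<open>T (- 1)\<close> is \<open>F\<close>-measurable.\<close>

locale past_recurrence = prob_space Q for Q :: "'x measure" +
  fixes F :: "'x measure" and T :: "int \<Rightarrow> 'x \<Rightarrow> 'x" and q :: "'x \<Rightarrow> 'c"
  assumes space_Q: "space Q = UNIV"
    and subalgebra: "subalgebra Q F"
    and T_0 [simp]: "T 0 x = x"
    and T_T [simp]: "T m (T n x) = T (m + n) x"
    and T_measurable [measurable]: "T n \<in> measurable Q Q"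
    and T_preserving: "distr Q Q (T n) = Q"
    and T_past: "T (- 1) \<in> measurable F F"
    and q_measurable: "q \<in> measurable F (count_space UNIV)"
    and q_finite: "finite (range q)"
begin

primrec return_time :: "'x \<Rightarrow> nat \<Rightarrow> nat" where
  "return_time x 0 = 0"
| "return_time x (Suc j) = (LEAST t. return_time x j < t \<and> q (T (- int t) x) = q x)"

text \<open>The value is positive even on paths that never return. Therefore \<open>S\<close> moves every path
  strictly into the past, which \<open>comp_S_past\<close> uses without exceptional set.\<close>

definition first_return :: "'x \<Rightarrow> nat" where
  "first_return x = Suc (LEAST u. q (T (- int (Suc u)) x) = q x)"

definition S :: "'x \<Rightarrow> 'x" where
  "S x = T (- int (first_return x)) x"

definition returns :: "'x \<Rightarrow> bool" where
  "returns x \<longleftrightarrow> (\<exists>t>0. q (T (- int t) x) = q x)"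

lemma T_past_funpow: "T (- int n) \<in> measurable F F"
proof (induction n)
  case 0
  have "T (- int 0) = (\<lambda>x. x)" by auto
  then show ?case by (simp only: measurable_ident_sets)
next
  case (Suc n)
  have "T (- int (Suc n)) = (\<lambda>x. T (- 1) (T (- int n) x))" by auto
  with measurable_compose[OF Suc T_past] show ?case by (simp only:)
qed

lemma F_imp_Q: "f \<in> measurable F N \<Longrightarrow> f \<in> measurable Q N"
  using measurable_from_subalg[OF subalgebra] .

lemma q_measurable_Q [measurable]: "q \<in> measurable Q (count_space UNIV)"
  using q_measurable by (rule F_imp_Q)

lemma pred_q_eq:
  assumes f: "f \<in> measurable N (count_space UNIV)" and g: "g \<in> measurable N (count_space UNIV)"
    and g_q: "\<And>x. g x \<in> range q"
  shows "Measurable.pred N (\<lambda>x. f x = (g x :: 'c))"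
proof -
  note f [measurable] g [measurable]
  have "(\<lambda>x. f x = g x) = (\<lambda>x. \<exists>w\<in>range q. f x = w \<and> g x = w)"
    using g_q by fastforce
  moreover have "Measurable.pred N (\<lambda>x. \<exists>w\<in>range q. f x = w \<and> g x = w)"
    by (rule pred_intros_finite) (use q_finite in auto)
  ultimately show ?thesis by simp
qed

lemma pred_return_F: "Measurable.pred F (\<lambda>x. q (T (- int t) x) = q x)"
  by (rule pred_q_eq[OF measurable_compose[OF T_past_funpow q_measurable] q_measurable]) (rule rangeI)

lemma pred_return [measurable]: "Measurable.pred Q (\<lambda>x. q (T n x) = q x)"
  by (rule pred_q_eq[OF measurable_compose[OF T_measurable q_measurable_Q] q_measurable_Q]) (rule rangeI)

lemma first_return_measurable_F: "first_return \<in> measurable F (count_space UNIV)"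
proof -
  note pred_return_F [measurable]
  have "(\<lambda>x. LEAST u. q (T (- int (Suc u)) x) = q x) \<in> measurable F (count_space UNIV)"
    by (rule measurable_Least) (rule pred_return_F)
  then show ?thesis unfolding first_return_def by measurable
qed

lemma first_return_measurable [measurable]: "first_return \<in> measurable Q (count_space UNIV)"
  by (rule F_imp_Q) (rule first_return_measurable_F)

lemma S_measurable [measurable]: "S \<in> measurable Q Q"
proof -
  have "(\<lambda>x. (\<lambda>n x. T (- int n) x) (first_return x) x) \<in> measurable Q Q"
    by (rule measurable_compose_countable) auto
  then show ?thesis unfolding S_def .
qed

text \<open>The map \<open>S\<close> looks back by at least one step, and by a number of steps which is itself determined by
  the past. It thus turns functions of past and present into functions of the past alone.\<close>

lemma comp_S_past:
  fixes h :: "'x \<Rightarrow> real"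
  assumes "(\<lambda>x. h (T (- 1) x)) \<in> borel_measurable F"
  shows "(\<lambda>x. h (S x)) \<in> borel_measurable F"
proof -
  have "(\<lambda>x. h (T (- int (Suc u)) x)) \<in> borel_measurable F" for u
    using measurable_compose[OF T_past_funpow[of u] assms] by simp
  then have "(\<lambda>x. (\<lambda>u x. h (T (- int (Suc u)) x)) (LEAST u. q (T (- int (Suc u)) x) = q x) x)
      \<in> borel_measurable F"
    by (rule measurable_compose_countable) (rule measurable_Least, rule pred_return_F)
  then show ?thesis by (simp add: S_def first_return_def)
qed

lemma AE_T: assumes "AE x in Q. P x" shows "AE x in Q. P (T n x)"
proof -
  have "AE x in distr Q Q (T n). P x" by (subst T_preserving) (rule assms)
  then show ?thesis by (rule AE_distrD[rotated]) simp
qed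

lemma measure_T: "A \<in> sets Q \<Longrightarrow> measure Q (T n -` A) = measure Q A"
  using measure_distr[of "T n" Q Q A] by (simp add: T_preserving space_Q)

text \<open>Poincare recurrence: within one cell of \<open>q\<close>, the preimages of the never returning points under
  the powers of \<open>T (- 1)\<close> are pairwise disjoint and have equal measure.\<close>

lemma poincare_once: "AE x in Q. returns x"
proof -
  have [measurable]: "Measurable.pred Q returns"
    unfolding returns_def by measurable
  have "measure Q {x. q x = w \<and> \<not> returns x} = 0" for w
  proof -
    let ?N = "{x. q x = w \<and> \<not> returns x}"
    have "{x\<in>space Q. q x = w \<and> \<not> returns x} \<in> sets Q" by measurable
    then have N: "?N \<in> sets Q" by (simp add: space_Q)
    have TN: "T (- int n) -` ?N \<in> sets Q" for n
      using measurable_sets[OF T_measurable N] by (simp add: space_Q)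
    have no: False if "n < m" "T (- int n) x \<in> ?N" "T (- int m) x \<in> ?N" for n m x
    proof -
      have "T (- int m) x = T (- int (m - n)) (T (- int n) x)" using that(1) by (simp add: of_nat_diff)
      then have "q (T (- int (m - n)) (T (- int n) x)) = q (T (- int n) x)" using that by simp
      then show False using that unfolding returns_def by (metis (mono_tags, lifting) mem_Collect_eq zero_less_diff)
    qed
    have "disjoint_family (\<lambda>n. T (- int n) -` ?N)"
      unfolding disjoint_family_on_def
    proof (intro ballI impI equals0I)
      fix m n :: nat and x assume "m \<noteq> n" "x \<in> T (- int m) -` ?N \<inter> T (- int n) -` ?N"
      then show False using no[of m n x] no[of n m x] by (cases m n rule: linorder_cases) auto
    qed
    then have "(\<lambda>n. measure Q (T (- int n) -` ?N)) sums measure Q (\<Union>n. T (- int n) -` ?N)"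
      by (intro finite_measure_UNION) (use TN in auto)
    then have "summable (\<lambda>n::nat. measure Q ?N)"
      using measure_T[OF N] by (simp add: sums_iff)
    then show ?thesis by (simp add: summable_const_iff)
  qed
  moreover have "{x\<in>space Q. q x = w \<and> \<not> returns x} \<in> sets Q" for w by measurable
  ultimately have "AE x in Q. \<not> (q x = w \<and> \<not> returns x)" for w
    by (subst AE_iff_measurable[OF _ refl]) (auto simp: space_Q emeasure_eq_measure)
  then have "AE x in Q. \<forall>w\<in>range q. \<not> (q x = w \<and> \<not> returns x)"
    unfolding AE_finite_all[OF q_finite] by blast
  then show ?thesis by eventually_elim auto
qed

lemma first_return_props:
  assumes "returns x"
  shows "0 < first_return x" "q (S x) = q x"
    "0 < s \<Longrightarrow> s < first_return x \<Longrightarrow> q (T (- int s) x) \<noteq> q x"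
proof -
  let ?P = "\<lambda>u. q (T (- int (Suc u)) x) = q x"
  obtain u where u: "?P u" using assms unfolding returns_def using gr0_implies_Suc by blast
  show "0 < first_return x" by (simp add: first_return_def)
  show "q (S x) = q x" unfolding S_def first_return_def by (rule LeastI[of ?P, OF u])
  show "0 < s \<Longrightarrow> s < first_return x \<Longrightarrow> q (T (- int s) x) \<noteq> q x"
    using not_less_Least[of "s - 1" ?P] unfolding first_return_def by (cases s) auto
qed

lemma first_return_eqI:
  assumes "0 < t" "q (T (- int t) x) = q x" "\<And>s. 0 < s \<Longrightarrow> s < t \<Longrightarrow> q (T (- int s) x) \<noteq> q x"
  shows "first_return x = t"
proof -
  have r: "returns x" using assms unfolding returns_def by auto
  show ?thesis
    using first_return_props[OF r] assms unfolding S_def by (metis linorder_neqE_nat)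
qed

text \<open>A path that returns for the first time after \<open>t\<close> steps backward is carried by \<open>S\<close> to one that returns for
  the first time after \<open>t\<close> steps forward, and conversely. So the part of the preimage of \<open>C\<close> with backward
  return time \<open>t\<close> is as large as the part of \<open>C\<close> with forward return time \<open>t\<close>.\<close>

lemma measure_S_le:
  assumes C [measurable]: "C \<in> sets Q"
  shows "measure Q {x. returns x \<and> S x \<in> C} \<le> measure Q C"
proof -
  define E where "E t = {x. 0 < t \<and> q (T (- int t) x) = q x \<and>
      (\<forall>s\<in>{0<..<t}. q (T (- int s) x) \<noteq> q x) \<and> T (- int t) x \<in> C}" for t :: nat
  define G where "G t = {y. y \<in> C \<and> 0 < t \<and> q (T (int t) y) = q y \<and>
      (\<forall>s\<in>{0<..<t}. q (T (int s) y) \<noteq> q y)}" for t :: nat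
  have "{x\<in>space Q. 0 < t \<and> q (T (- int t) x) = q x \<and>
      (\<forall>s\<in>{0<..<t}. q (T (- int s) x) \<noteq> q x) \<and> T (- int t) x \<in> C} \<in> sets Q" for t :: nat
    by measurable
  then have E_sets: "E t \<in> sets Q" for t by (simp add: E_def space_Q)
  have "{y\<in>space Q. y \<in> C \<and> 0 < t \<and> q (T (int t) y) = q y \<and>
      (\<forall>s\<in>{0<..<t}. q (T (int s) y) \<noteq> q y)} \<in> sets Q" for t :: nat
    by measurable
  then have G_sets: "G t \<in> sets Q" for t by (simp add: G_def space_Q)
  have EG: "E t = T (- int t) -` G t" for t
  proof -
    \<comment> \<open>Reversal of time inside the excursion: the substitution of \<open>t - s\<close> for \<open>s\<close>.\<close>
    have *: "(\<forall>s\<in>{0<..<t}. q (T (- int s) x) \<noteq> c) \<longleftrightarrow>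
        (\<forall>s\<in>{0<..<t}. q (T (int s - int t) x) \<noteq> c)" (is "?L \<longleftrightarrow> ?R") for x c
    proof
      assume L: ?L
      show ?R
      proof
        fix s assume "s \<in> {0<..<t}"
        then have "t - s \<in> {0<..<t}" "- int (t - s) = int s - int t" by auto
        then show "q (T (int s - int t) x) \<noteq> c" using L by metis
      qed
    next
      assume R: ?R
      show ?L
      proof
        fix s assume "s \<in> {0<..<t}"
        then have "t - s \<in> {0<..<t}" "int (t - s) - int t = - int s" by auto
        then show "q (T (- int s) x) \<noteq> c" using R by metis
      qed
    qed
    show ?thesis
      unfolding E_def G_def using * by (auto simp: set_eq_iff)
  qed
  have E_first: "first_return x = t" if "x \<in> E t" for x t
    using that unfolding E_def by (intro first_return_eqI) auto
  have E_Un: "{x. returns x \<and> S x \<in> C} = (\<Union>t. E t)"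
  proof (intro set_eqI iffI)
    fix x assume "x \<in> {x. returns x \<and> S x \<in> C}"
    then have "x \<in> E (first_return x)"
      using first_return_props[of x] by (auto simp: E_def S_def)
    then show "x \<in> (\<Union>t. E t)" by blast
  next
    fix x assume "x \<in> (\<Union>t. E t)"
    then obtain t where "x \<in> E t" by blast
    with E_first[OF this] show "x \<in> {x. returns x \<and> S x \<in> C}"
      by (auto simp: E_def S_def returns_def)
  qed
  have "disjoint_family E"
    unfolding disjoint_family_on_def by (auto dest: E_first)
  then have "(\<lambda>t. measure Q (E t)) sums measure Q (\<Union>t. E t)"
    by (intro finite_measure_UNION) (use E_sets in auto)
  moreover have "disjoint_family G"
    unfolding disjoint_family_on_def
  proof (intro ballI impI equals0I)
    fix m n :: nat and x assume "m \<noteq> n" "x \<in> G m \<inter> G n"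
    then show False by (cases m n rule: linorder_cases) (auto simp: G_def)
  qed
  then have "(\<lambda>t. measure Q (G t)) sums measure Q (\<Union>t. G t)"
    by (intro finite_measure_UNION) (use G_sets in auto)
  moreover have "measure Q (E t) = measure Q (G t)" for t
    unfolding EG by (rule measure_T) (rule G_sets)
  ultimately have "measure Q (\<Union>t. E t) = measure Q (\<Union>t. G t)"
    by (simp add: sums_iff)
  also have "\<dots> \<le> measure Q C"
    by (rule finite_measure_mono) (auto simp: G_def)
  finally show ?thesis by (simp add: E_Un)
qed

text \<open>The inequality for a set and for its complement gives equality, because both measures have total
  mass \<open>1\<close>.\<close>

lemma S_preserving: "distr Q Q S = Q"
proof (rule measure_eqI)
  fix C assume "C \<in> sets (distr Q Q S)"
  then have C [measurable]: "C \<in> sets Q" by simp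
  have [measurable]: "Measurable.pred Q returns"
    unfolding returns_def by measurable
  have le: "measure Q (S -` D) \<le> measure Q D" if D [measurable]: "D \<in> sets Q" for D
  proof -
    have "{x\<in>space Q. returns x \<and> S x \<in> D} \<in> sets Q" by measurable
    moreover have "S -` D \<inter> space Q \<in> sets Q" by measurable
    ultimately have "measure Q (S -` D) = measure Q {x. returns x \<and> S x \<in> D}"
      using poincare_once by (intro finite_measure_eq_AE) (auto simp: space_Q)
    with measure_S_le[OF D] show ?thesis by simp
  qed
  have SC: "S -` C \<in> sets Q" using measurable_sets[OF S_measurable C] by (simp add: space_Q)
  have "measure Q (S -` (space Q - C)) = 1 - measure Q (S -` C)"
    using prob_compl[OF SC] by (simp add: space_Q vimage_Compl Compl_eq_Diff_UNIV[symmetric])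
  moreover have "measure Q (space Q - C) = 1 - measure Q C" by (rule prob_compl) (rule C)
  moreover have "space Q - C \<in> sets Q" by measurable
  ultimately have "measure Q (S -` C) = measure Q C" using le[of C] le[of "space Q - C"] C by fastforce
  then show "emeasure (distr Q Q S) C = emeasure Q C"
    by (simp add: emeasure_distr emeasure_eq_measure space_Q)
qed simp

text \<open>The orbit of \<open>S\<close> stays in one cell of \<open>q\<close>, so returning to the cell of the current point is the same as
  returning to the cell of the initial one.\<close>

lemma return_time_eq_iterate:
  assumes "\<And>n. returns (T (- int n) x)"
  shows "T (- int (return_time x j)) x = (S ^^ j) x \<and> q ((S ^^ j) x) = q x"
proof (induction j)
  case (Suc j)
  let ?a = "return_time x j" and ?y = "(S ^^ j) x"
  have y: "?y = T (- int ?a) x" by (rule conjunct1[OF Suc.IH, symmetric])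
  have q_y: "q ?y = q x" by (rule conjunct2[OF Suc.IH])
  have r: "returns ?y" unfolding y by (rule assms)
  have shift: "T (- int (?a + u)) x = T (- int u) ?y" for u
    unfolding y T_T by (rule arg_cong[where f = "\<lambda>n. T n x"]) simp
  have "return_time x (Suc j) = ?a + first_return ?y"
    unfolding return_time.simps
  proof (rule Least_equality)
    show "?a < ?a + first_return ?y \<and> q (T (- int (?a + first_return ?y)) x) = q x"
      using first_return_props[OF r] q_y unfolding shift S_def by simp
  next
    fix t assume t: "?a < t \<and> q (T (- int t) x) = q x"
    show "?a + first_return ?y \<le> t"
    proof (rule ccontr)
      assume "\<not> ?a + first_return ?y \<le> t"
      then have "q (T (- int (t - ?a)) ?y) \<noteq> q ?y"
        using t by (intro first_return_props(3)[OF r]) auto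
      then show False using t q_y shift[of "t - ?a"] by simp
    qed
  qed
  then have "T (- int (return_time x (Suc j))) x = S ?y"
    by (simp only: shift S_def[of ?y])
  then show ?case using first_return_props(2)[OF r] q_y by simp
qed simp

lemma AE_return_time_eq_iterate:
  "AE x in Q. \<forall>j. T (- int (return_time x j)) x = (S ^^ j) x \<and> q ((S ^^ j) x) = q x"
proof -
  have "AE x in Q. \<forall>n. returns (T (- int n) x)"
    by (intro AE_all_countable[THEN iffD2] allI AE_T poincare_once)
  then show ?thesis by eventually_elim (intro allI return_time_eq_iterate, blast)
qed

section \<open>Averages along the orbit of recurrences\<close>

lemma integral_comp_S:
  fixes h :: "'x \<Rightarrow> real"
  assumes "h \<in> borel_measurable Q"
  shows "(\<integral>x. h (S x) \<partial>Q) = (\<integral>x. h x \<partial>Q)"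
  using integral_distr[OF S_measurable assms] by (simp only: S_preserving)

lemma funpow_S_measurable [measurable]: "S ^^ j \<in> measurable Q Q"
proof (induction j)
  case (Suc j)
  then show ?case using measurable_comp[OF Suc S_measurable] by simp
qed (simp add: id_def)

lemma distr_funpow_S: "distr Q Q (S ^^ j) = Q"
proof (induction j)
  case (Suc j)
  have "distr Q Q (S ^^ Suc j) = distr (distr Q Q (S ^^ j)) Q S"
    by (subst distr_distr) auto
  then show ?case by (simp only: Suc S_preserving)
qed (simp add: id_def distr_id)

lemma integral_funpow_S:
  fixes h :: "'x \<Rightarrow> real"
  assumes "h \<in> borel_measurable Q"
  shows "(\<integral>x. h ((S ^^ j) x) \<partial>Q) = (\<integral>x. h x \<partial>Q)"
  using integral_distr[OF funpow_S_measurable assms] by (simp only: distr_funpow_S)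

lemma integrable_funpow_S:
  fixes h :: "'x \<Rightarrow> real"
  assumes "integrable Q h"
  shows "integrable Q (\<lambda>x. h ((S ^^ j) x))"
  by (rule integrable_distr[OF funpow_S_measurable]) (simp only: distr_funpow_S assms)

text \<open>If \<open>D n\<close> is the orbit sum of length \<open>n\<close>, then \<open>D (Suc n)\<close> is \<open>d\<close> plus \<open>D n\<close> composed with \<open>S\<close>. The second
  summand is a function of the past, hence orthogonal to \<open>d\<close>, and by invariance it has the norm of
  \<open>D n\<close>. Each step thus adds the square norm of \<open>d\<close>.\<close>

lemma integral_square_orbit_sum:
  fixes d :: "'x \<Rightarrow> real"
  assumes d [measurable]: "d \<in> borel_measurable Q"
    and d_past: "(\<lambda>x. d (T (- 1) x)) \<in> borel_measurable F"
    and d_bound: "\<And>x. \<bar>d x\<bar> \<le> c"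
    and orth: "\<And>h C. h \<in> borel_measurable F \<Longrightarrow> (\<And>x. \<bar>h x\<bar> \<le> C) \<Longrightarrow> (\<integral>x. h x * d x \<partial>Q) = 0"
  shows "(\<integral>x. (\<Sum>j<n. d ((S ^^ j) x))\<^sup>2 \<partial>Q) = real n * (\<integral>x. (d x)\<^sup>2 \<partial>Q)"
proof (induction n)
  case (Suc n)
  define D where "D n x = (\<Sum>j<n. d ((S ^^ j) x))" for n x
  have D_Suc: "D (Suc n) x = d x + D n (S x)" for n x
    unfolding D_def sum.lessThan_Suc_shift by (simp add: funpow_swap1)
  have [measurable]: "D n \<in> borel_measurable Q" for n
    unfolding D_def by measurable
  have D_past: "(\<lambda>x. D n (T (- 1) x)) \<in> borel_measurable F" for n
  proof (induction n)
    case (Suc n)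
    have "(\<lambda>x. D n (S (T (- 1) x))) \<in> borel_measurable F"
      using measurable_compose[OF T_past comp_S_past[OF Suc]] .
    then show ?case unfolding D_Suc by (rule borel_measurable_add[OF d_past])
  qed (simp add: D_def)
  have D_bound: "\<bar>D n x\<bar> \<le> real n * c" for n x
    unfolding D_def using sum_norm_le[of "{..<n}" "\<lambda>j. d ((S ^^ j) x)" "\<lambda>_. c"] d_bound by simp
  have int [simp]: "integrable Q h" if "h \<in> borel_measurable Q" "\<And>x. \<bar>h x\<bar> \<le> C" for h :: "'x \<Rightarrow> real" and C
    using that by (intro integrable_const_bound[where B = C]) auto
  have c: "0 \<le> c" using d_bound[of undefined] by linarith
  have cross: "(\<integral>x. D n (S x) * d x \<partial>Q) = 0"
    by (rule orth[of _ "real n * c"]) (auto intro: comp_S_past[OF D_past] D_bound)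
  have i1: "integrable Q (\<lambda>x. (d x)\<^sup>2)"
    using power_mono[OF d_bound abs_ge_zero, of _ 2] by (intro int[of _ "c\<^sup>2"]) auto
  have i2: "integrable Q (\<lambda>x. D n (S x) * d x)"
    using mult_mono[OF D_bound d_bound] c
    by (intro int[of _ "real n * c * c"]) (auto simp: abs_mult)
  have i3: "integrable Q (\<lambda>x. (D n (S x))\<^sup>2)"
    using power_mono[OF D_bound abs_ge_zero, of _ _ 2] by (intro int[of _ "(real n * c)\<^sup>2"]) auto
  have "(\<integral>x. (D (Suc n) x)\<^sup>2 \<partial>Q) = (\<integral>x. (d x)\<^sup>2 + 2 * (D n (S x) * d x) + (D n (S x))\<^sup>2 \<partial>Q)"
    by (intro Bochner_Integration.integral_cong) (auto simp: D_Suc power2_sum algebra_simps)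
  also have "\<dots> = (\<integral>x. (d x)\<^sup>2 \<partial>Q) + (\<integral>x. (D n (S x))\<^sup>2 \<partial>Q)"
    using i1 i2 i3 cross by simp
  also have "(\<integral>x. (D n (S x))\<^sup>2 \<partial>Q) = (\<integral>x. (D n x)\<^sup>2 \<partial>Q)"
    by (rule integral_comp_S) measurable
  also have "\<dots> = real n * (\<integral>x. (d x)\<^sup>2 \<partial>Q)"
    using Suc by (simp only: D_def)
  finally show ?case unfolding D_def by (simp add: algebra_simps)
qed simp

lemma integral_abs_le_sqrt:
  fixes h :: "'x \<Rightarrow> real"
  assumes "integrable Q h" "integrable Q (\<lambda>x. (h x)\<^sup>2)"
  shows "(\<integral>x. \<bar>h x\<bar> \<partial>Q) \<le> sqrt (\<integral>x. (h x)\<^sup>2 \<partial>Q)"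
proof (rule real_le_rsqrt)
  have "0 \<le> variance (\<lambda>x. \<bar>h x\<bar>)" by (rule variance_positive)
  also have "\<dots> = (\<integral>x. \<bar>h x\<bar>\<^sup>2 \<partial>Q) - (\<integral>x. \<bar>h x\<bar> \<partial>Q)\<^sup>2"
    using assms by (intro variance_eq) auto
  finally show "(\<integral>x. \<bar>h x\<bar> \<partial>Q)\<^sup>2 \<le> (\<integral>x. (h x)\<^sup>2 \<partial>Q)" by simp
qed

text \<open>The first term bounds the average of the martingale differences \<open>f - g\<close>. The second one collects
  the average of \<open>\<bar>g - h\<bar>\<close> along the orbit and the distance from \<open>h\<close> back to \<open>g\<close>.\<close>

lemma recurrence_average_L1_bound:
  fixes f h :: "'x \<Rightarrow> real"
  assumes f [measurable]: "f \<in> borel_measurable Q"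
    and f_past: "(\<lambda>x. f (T (- 1) x)) \<in> borel_measurable F"
    and f_bound: "\<And>x. \<bar>f x\<bar> \<le> 1"
    and h: "integrable Q h" "\<And>x y. q x = q y \<Longrightarrow> h x = h y"
    and n: "0 < n"
  shows "(\<integral>x. \<bar>1 / real n * (\<Sum>j=1..n. f (T (- int (return_time x j)) x)) - real_cond_exp Q F f x\<bar> \<partial>Q)
    \<le> 2 / sqrt (real n) + 2 * (\<integral>x. \<bar>real_cond_exp Q F f x - h x\<bar> \<partial>Q)"
proof -
  interpret finite_measure_subalgebra Q F by unfold_locales (rule subalgebra)
  have int_f: "integrable Q f" using f_bound by (intro integrable_const_bound[where B = 1]) auto
  \<comment> \<open>The conditional expectation is bounded only almost everywhere; truncation gives a version that is
    bounded everywhere.\<close>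
  define g where "g x = max (- 1) (min 1 (real_cond_exp Q F f x))" for x
  have g_F [measurable]: "g \<in> borel_measurable F" unfolding g_def by measurable
  have g_Q [measurable]: "g \<in> borel_measurable Q" by (rule F_imp_Q) (rule g_F)
  have g_bound: "\<bar>g x\<bar> \<le> 1" for x unfolding g_def by auto
  have int_g: "integrable Q g" using g_bound by (intro integrable_const_bound[where B = 1]) auto
  have "AE x in Q. real_cond_exp Q F f x \<le> 1"
    by (rule real_cond_exp_le_c[OF int_f]) (use f_bound in \<open>simp add: abs_le_iff\<close>)
  moreover have "AE x in Q. - 1 \<le> real_cond_exp Q F f x"
    by (rule real_cond_exp_ge_c[OF int_f]) (use f_bound in \<open>simp add: abs_le_iff minus_le_iff\<close>)
  ultimately have g_eq: "AE x in Q. real_cond_exp Q F f x = g x"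
    by eventually_elim (simp add: g_def)
  define d where "d x = f x - g x" for x
  have d [measurable]: "d \<in> borel_measurable Q" unfolding d_def by measurable
  have d_bound: "\<bar>d x\<bar> \<le> 2" for x unfolding d_def using f_bound[of x] g_bound[of x] by linarith
  have d_past: "(\<lambda>x. d (T (- 1) x)) \<in> borel_measurable F"
    unfolding d_def using f_past measurable_compose[OF T_past g_F] by (rule borel_measurable_diff)
  have orth: "(\<integral>x. k x * d x \<partial>Q) = 0"
    if k_F: "k \<in> borel_measurable F" and k_bound: "\<And>x. \<bar>k x\<bar> \<le> C" for k C
  proof -
    have k [measurable]: "k \<in> borel_measurable Q" by (rule F_imp_Q) (rule k_F)
    have le: "\<bar>k x * u x\<bar> \<le> C" if "\<bar>u x\<bar> \<le> 1" for u :: "'x \<Rightarrow> real" and x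
      using mult_mono[OF k_bound that] k_bound[of x] by (simp add: abs_mult)
    have ikf: "integrable Q (\<lambda>x. k x * f x)"
      by (rule integrable_const_bound[where B = C]) (use le f_bound in auto)
    have ikg: "integrable Q (\<lambda>x. k x * g x)"
      by (rule integrable_const_bound[where B = C]) (use le g_bound in auto)
    have "(\<integral>x. k x * g x \<partial>Q) = (\<integral>x. k x * real_cond_exp Q F f x \<partial>Q)"
      by (rule integral_cong_AE) (use g_eq in auto)
    also have "\<dots> = (\<integral>x. k x * f x \<partial>Q)"
      by (rule real_cond_exp_intg(2)[OF ikf k_F f])
    finally show ?thesis using ikf ikg unfolding d_def by (simp add: right_diff_distrib)
  qed
  define D where "D x = (\<Sum>j<n. d ((S ^^ j) x))" for x
  have D [measurable]: "D \<in> borel_measurable Q" unfolding D_def by measurable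
  have D_bound: "\<bar>D x\<bar> \<le> real n * 2" for x
    unfolding D_def using sum_norm_le[of "{..<n}" "\<lambda>j. d ((S ^^ j) x)" "\<lambda>_. 2"] d_bound by simp
  have int_D: "integrable Q D" using D_bound by (intro integrable_const_bound[where B = "real n * 2"]) auto
  have int_D2: "integrable Q (\<lambda>x. (D x)\<^sup>2)"
    using power_mono[OF D_bound abs_ge_zero, of _ 2]
    by (intro integrable_const_bound[where B = "(real n * 2)\<^sup>2"]) auto
  have "(\<integral>x. (d x)\<^sup>2 \<partial>Q) \<le> (\<integral>x. 4 \<partial>Q)"
  proof (rule integral_mono')
    show "(d x)\<^sup>2 \<le> 4" for x using power_mono[OF d_bound abs_ge_zero, of x 2] by simp
  qed auto
  then have d2: "(\<integral>x. (d x)\<^sup>2 \<partial>Q) \<le> 4" by (simp add: prob_space)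
  have "(\<integral>x. \<bar>D (S x)\<bar> \<partial>Q) = (\<integral>x. \<bar>D x\<bar> \<partial>Q)"
    by (rule integral_comp_S) measurable
  also have "\<dots> \<le> sqrt (\<integral>x. (D x)\<^sup>2 \<partial>Q)"
    by (rule integral_abs_le_sqrt[OF int_D int_D2])
  also have "(\<integral>x. (D x)\<^sup>2 \<partial>Q) = real n * (\<integral>x. (d x)\<^sup>2 \<partial>Q)"
    unfolding D_def by (rule integral_square_orbit_sum[OF d d_past d_bound orth])
  also have "sqrt \<dots> \<le> sqrt (real n * 4)"
    using d2 by (intro real_sqrt_le_mono mult_left_mono) auto
  finally have D_L1: "(\<integral>x. \<bar>D (S x)\<bar> \<partial>Q) \<le> 2 * sqrt (real n)"
    by (simp add: real_sqrt_mult)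
  define e where "e x = \<bar>g x - h x\<bar>" for x
  have int_e: "integrable Q e" unfolding e_def using int_g h(1) by auto
  have e [measurable]: "e \<in> borel_measurable Q" using int_e by simp
  let ?A = "\<lambda>x. 1 / real n * (\<Sum>j=1..n. f (T (- int (return_time x j)) x)) - real_cond_exp Q F f x"
  let ?R = "\<lambda>x. 1 / real n * \<bar>D (S x)\<bar> + 1 / real n * (\<Sum>j<n. e ((S ^^ Suc j) x)) + e x"
  have le: "AE x in Q. \<bar>?A x\<bar> \<le> ?R x"
    using AE_return_time_eq_iterate g_eq
  proof eventually_elim
    case (elim x)
    have hS: "h ((S ^^ j) x) = h x" for j using elim(1) h(2) by blast
    have "(\<Sum>j=1..n. f (T (- int (return_time x j)) x)) = (\<Sum>j=1..n. f ((S ^^ j) x))"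
      using elim(1) by simp
    also have "\<dots> = (\<Sum>j<n. f ((S ^^ Suc j) x))"
      by (rule sum.reindex_bij_witness[of _ Suc "\<lambda>j. j - 1"]) auto
    also have "\<dots> = (\<Sum>j<n. d ((S ^^ Suc j) x) + (g ((S ^^ Suc j) x) - h ((S ^^ Suc j) x)) + h x)"
      by (simp only: hS d_def) simp
    also have "\<dots> = (\<Sum>j<n. d ((S ^^ Suc j) x)) + (\<Sum>j<n. g ((S ^^ Suc j) x) - h ((S ^^ Suc j) x)) + real n * h x"
      by (simp add: sum.distrib)
    also have "(\<Sum>j<n. d ((S ^^ Suc j) x)) = D (S x)"
      unfolding D_def by (simp add: funpow_swap1)
    finally have eq: "?A x = 1 / real n * D (S x)
        + 1 / real n * (\<Sum>j<n. g ((S ^^ Suc j) x) - h ((S ^^ Suc j) x)) + (h x - g x)"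
      using n elim(2) by (simp only: ) (simp add: field_simps)
    have s: "\<bar>\<Sum>j<n. g ((S ^^ Suc j) x) - h ((S ^^ Suc j) x)\<bar> \<le> (\<Sum>j<n. e ((S ^^ Suc j) x))"
      unfolding e_def by (rule sum_abs)
    have "\<bar>?A x\<bar> \<le> \<bar>1 / real n * D (S x)\<bar>
        + \<bar>1 / real n * (\<Sum>j<n. g ((S ^^ Suc j) x) - h ((S ^^ Suc j) x))\<bar> + \<bar>h x - g x\<bar>"
      unfolding eq by linarith
    also have "\<dots> \<le> ?R x"
      using mult_left_mono[OF s, of "1 / real n"] by (simp add: abs_mult e_def abs_minus_commute)
    finally show ?case .
  qed
  have int_DS: "integrable Q (\<lambda>x. \<bar>D (S x)\<bar>)"
    using integrable_funpow_S[OF int_D, of 1] by simp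
  have int_eS: "integrable Q (\<lambda>x. e ((S ^^ j) x))" for j
    by (rule integrable_funpow_S[OF int_e])
  have int_R: "integrable Q ?R"
    by (intro Bochner_Integration.integrable_add integrable_mult_right int_DS
        Bochner_Integration.integrable_sum int_eS int_e)
  have "(\<integral>x. \<bar>?A x\<bar> \<partial>Q) \<le> (\<integral>x. ?R x \<partial>Q)"
    by (rule integral_mono_AE'[OF int_R le])
      (auto intro!: AE_I2 add_nonneg_nonneg divide_nonneg_nonneg sum_nonneg simp: e_def)
  also have "\<dots> = 1 / real n * (\<integral>x. \<bar>D (S x)\<bar> \<partial>Q) + 1 / real n * (\<Sum>j<n. \<integral>x. e ((S ^^ Suc j) x) \<partial>Q) + (\<integral>x. e x \<partial>Q)"
    using int_DS int_eS int_e
    by (simp del: funpow.simps add: Bochner_Integration.integral_add Bochner_Integration.integral_sum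
        Bochner_Integration.integrable_sum)
  also have "(\<Sum>j<n. \<integral>x. e ((S ^^ Suc j) x) \<partial>Q) = real n * (\<integral>x. e x \<partial>Q)"
    unfolding integral_funpow_S[OF e] by simp
  also have "(\<integral>x. e x \<partial>Q) = (\<integral>x. \<bar>real_cond_exp Q F f x - h x\<bar> \<partial>Q)"
    by (rule integral_cong_AE) (use g_eq h(1) in \<open>auto simp: e_def\<close>)
  finally have "(\<integral>x. \<bar>?A x\<bar> \<partial>Q) \<le> 1 / real n * (\<integral>x. \<bar>D (S x)\<bar> \<partial>Q)
      + 2 * (\<integral>x. \<bar>real_cond_exp Q F f x - h x\<bar> \<partial>Q)" using n by simp
  moreover have "1 / real n * (\<integral>x. \<bar>D (S x)\<bar> \<partial>Q) \<le> 1 / real n * (2 * sqrt (real n))"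
    using D_L1 by (intro mult_left_mono) auto
  moreover have "1 / real n * (2 * sqrt (real n)) = 2 / sqrt (real n)"
    using n by (simp add: field_simps)
  ultimately show ?thesis by linarith
qed

lemma return_time_measurable: "(\<lambda>x. return_time x j) \<in> measurable Q (count_space UNIV)"
proof (induction j)
  case (Suc j)
  note Suc [measurable]
  show ?case unfolding return_time.simps by measurable
qed simp

lemma recurrence_average_measurable:
  fixes f :: "'x \<Rightarrow> real"
  assumes [measurable]: "f \<in> borel_measurable Q"
  shows "(\<lambda>x. 1 / real n * (\<Sum>j=1..n. f (T (- int (return_time x j)) x))) \<in> borel_measurable Q"
proof -
  have [measurable]: "(\<lambda>x. f (T (- int (return_time x j)) x)) \<in> borel_measurable Q" for j
    by (rule measurable_compose_countable[OF _ return_time_measurable]) measurable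
  show ?thesis by measurable
qed

end

section \<open>Approximation by functions of a quantised past\<close>

text \<open>A function is in this class if it belongs to the \<open>L\<^sup>1\<close> closure of the functions that are constant on the
  cells of some \<open>q k\<close>. The class takes the place of Levy's upward theorem for the conditional
  expectations given \<open>q k\<close>.\<close>

definition cell_approximable :: "'x measure \<Rightarrow> (nat \<Rightarrow> 'x \<Rightarrow> 'c) \<Rightarrow> ('x \<Rightarrow> real) \<Rightarrow> bool" where
  "cell_approximable Q q g \<longleftrightarrow> integrable Q g \<and> (\<forall>\<epsilon>>0. \<exists>k\<ge>1. \<exists>h. integrable Q h \<and>
     (\<forall>x y. q k x = q k y \<longrightarrow> h x = h y) \<and> (\<integral>x. \<bar>g x - h x\<bar> \<partial>Q) < \<epsilon>)"

lemma cell_approximable_L1_closed: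
  assumes g: "integrable Q g"
    and near: "\<And>\<epsilon>. 0 < \<epsilon> \<Longrightarrow> \<exists>g'. cell_approximable Q q g' \<and> (\<integral>x. \<bar>g x - g' x\<bar> \<partial>Q) < \<epsilon>"
  shows "cell_approximable Q q g"
  unfolding cell_approximable_def
proof (intro conjI allI impI g)
  fix \<epsilon> :: real assume "0 < \<epsilon>"
  then have e: "0 < \<epsilon> / 2" by simp
  obtain g' where g': "cell_approximable Q q g'" "(\<integral>x. \<bar>g x - g' x\<bar> \<partial>Q) < \<epsilon> / 2"
    using near[OF e] by blast
  then obtain k h where k: "1 \<le> k" and h: "integrable Q h" "\<forall>x y. q k x = q k y \<longrightarrow> h x = h y"
      "(\<integral>x. \<bar>g' x - h x\<bar> \<partial>Q) < \<epsilon> / 2"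
    using e unfolding cell_approximable_def by meson
  have g'_int: "integrable Q g'" using g'(1) unfolding cell_approximable_def by blast
  have "(\<integral>x. \<bar>g x - h x\<bar> \<partial>Q) \<le> (\<integral>x. \<bar>g x - g' x\<bar> + \<bar>g' x - h x\<bar> \<partial>Q)"
    by (rule integral_mono) (use g g'_int h(1) in auto)
  also have "\<dots> = (\<integral>x. \<bar>g x - g' x\<bar> \<partial>Q) + (\<integral>x. \<bar>g' x - h x\<bar> \<partial>Q)"
    by (rule Bochner_Integration.integral_add) (use g g'_int h(1) in auto)
  also have "\<dots> < \<epsilon>" using g'(2) h(3) by linarith
  finally show "\<exists>k\<ge>1. \<exists>h. integrable Q h \<and> (\<forall>x y. q k x = q k y \<longrightarrow> h x = h y) \<and>
      (\<integral>x. \<bar>g x - h x\<bar> \<partial>Q) < \<epsilon>"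
    using k h by blast
qed

lemma cell_approximable_self:
  assumes "integrable Q h" "1 \<le> k" "\<And>x y. q k x = q k y \<Longrightarrow> h x = h y"
  shows "cell_approximable Q q h"
  unfolding cell_approximable_def
proof (intro conjI allI impI assms(1))
  fix \<epsilon> :: real assume "0 < \<epsilon>"
  then show "\<exists>k\<ge>1. \<exists>h'. integrable Q h' \<and> (\<forall>x y. q k x = q k y \<longrightarrow> h' x = h' y) \<and>
      (\<integral>x. \<bar>h x - h' x\<bar> \<partial>Q) < \<epsilon>"
    by (intro exI[of _ k] conjI exI[of _ h] assms(1,2) allI impI assms(3)) simp_all
qed

lemma cell_approximable_scale:
  assumes "cell_approximable Q q g"
  shows "cell_approximable Q q (\<lambda>x. c * g x)"
  unfolding cell_approximable_def
proof (intro conjI allI impI)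
  have g: "integrable Q g" using assms unfolding cell_approximable_def by blast
  then show "integrable Q (\<lambda>x. c * g x)" by simp
  fix \<epsilon> :: real assume "0 < \<epsilon>"
  then have e: "0 < \<epsilon> / (\<bar>c\<bar> + 1)" by simp
  obtain k h where k: "1 \<le> k" and h: "integrable Q h" "\<forall>x y. q k x = q k y \<longrightarrow> h x = h y"
      "(\<integral>x. \<bar>g x - h x\<bar> \<partial>Q) < \<epsilon> / (\<bar>c\<bar> + 1)"
    using assms e unfolding cell_approximable_def by meson
  have "(\<integral>x. \<bar>c * g x - c * h x\<bar> \<partial>Q) = (\<integral>x. \<bar>c\<bar> * \<bar>g x - h x\<bar> \<partial>Q)"
    by (simp add: right_diff_distrib[symmetric] abs_mult)
  also have "\<dots> \<le> (\<bar>c\<bar> + 1) * (\<integral>x. \<bar>g x - h x\<bar> \<partial>Q)"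
    by (simp add: mult_right_mono)
  also have "\<dots> < \<epsilon>" using h(3) by (simp add: field_simps)
  finally have "(\<integral>x. \<bar>c * g x - c * h x\<bar> \<partial>Q) < \<epsilon>" .
  moreover have "integrable Q (\<lambda>x. c * h x)" using h(1) by simp
  moreover have "\<forall>x y. q k x = q k y \<longrightarrow> c * h x = c * h y" using h(2) by metis
  ultimately show "\<exists>k\<ge>1. \<exists>h. integrable Q h \<and> (\<forall>x y. q k x = q k y \<longrightarrow> h x = h y) \<and>
      (\<integral>x. \<bar>c * g x - h x\<bar> \<partial>Q) < \<epsilon>"
    using k by (intro exI[of _ k] conjI exI[of _ "\<lambda>x. c * h x"])
qed

lemma cell_approximable_add:
  assumes refine: "\<And>k m x y. 1 \<le> k \<Longrightarrow> k \<le> m \<Longrightarrow> q m x = q m y \<Longrightarrow> q k x = q k y"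
    and f: "cell_approximable Q q f" and g: "cell_approximable Q q g"
  shows "cell_approximable Q q (\<lambda>x. f x + g x)"
  unfolding cell_approximable_def
proof (intro conjI allI impI)
  have fg: "integrable Q f" "integrable Q g" using f g unfolding cell_approximable_def by auto
  then show "integrable Q (\<lambda>x. f x + g x)" by simp
  fix \<epsilon> :: real assume "0 < \<epsilon>"
  then have e: "0 < \<epsilon> / 2" by simp
  obtain k h where k: "1 \<le> k" and h: "integrable Q h" "\<forall>x y. q k x = q k y \<longrightarrow> h x = h y"
      "(\<integral>x. \<bar>f x - h x\<bar> \<partial>Q) < \<epsilon> / 2"
    using f e unfolding cell_approximable_def by meson
  obtain m u where m: "1 \<le> m" and u: "integrable Q u" "\<forall>x y. q m x = q m y \<longrightarrow> u x = u y"
      "(\<integral>x. \<bar>g x - u x\<bar> \<partial>Q) < \<epsilon> / 2"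
    using g e unfolding cell_approximable_def by meson
  have "(\<integral>x. \<bar>(f x + g x) - (h x + u x)\<bar> \<partial>Q) \<le> (\<integral>x. \<bar>f x - h x\<bar> + \<bar>g x - u x\<bar> \<partial>Q)"
    by (rule integral_mono) (use fg h(1) u(1) in auto)
  also have "\<dots> = (\<integral>x. \<bar>f x - h x\<bar> \<partial>Q) + (\<integral>x. \<bar>g x - u x\<bar> \<partial>Q)"
    by (rule Bochner_Integration.integral_add) (use fg h(1) u(1) in auto)
  also have "\<dots> < \<epsilon>" using h(3) u(3) by linarith
  finally have "(\<integral>x. \<bar>(f x + g x) - (h x + u x)\<bar> \<partial>Q) < \<epsilon>" .
  moreover have "integrable Q (\<lambda>x. h x + u x)" using h(1) u(1) by simp
  moreover have "\<forall>x y. q (max k m) x = q (max k m) y \<longrightarrow> h x + u x = h y + u y"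
  proof (intro allI impI)
    fix x y assume eq: "q (max k m) x = q (max k m) y"
    have "q k x = q k y" by (rule refine[OF k _ eq]) simp
    moreover have "q m x = q m y" by (rule refine[OF m _ eq]) simp
    ultimately show "h x + u x = h y + u y" using h(2) u(2) by metis
  qed
  moreover have "1 \<le> max k m" using k by simp
  ultimately show "\<exists>k\<ge>1. \<exists>h. integrable Q h \<and> (\<forall>x y. q k x = q k y \<longrightarrow> h x = h y) \<and>
      (\<integral>x. \<bar>f x + g x - h x\<bar> \<partial>Q) < \<epsilon>"
    by (intro exI[of _ "max k m"] conjI exI[of _ "\<lambda>x. h x + u x"])
qed

text \<open>The sets that are unions of cells of some \<open>q k\<close> are stable under intersection because the partitions
  refine each other, and the class is closed under complements and countable disjoint unions.\<close>

lemma cell_approximable_indicator: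
  fixes q :: "nat \<Rightarrow> 'x \<Rightarrow> 'c"
  assumes "prob_space Q" and space_Q: "space Q = UNIV"
    and refine: "\<And>k m x y. 1 \<le> k \<Longrightarrow> k \<le> m \<Longrightarrow> q m x = q m y \<Longrightarrow> q k x = q k y"
    and A: "A \<in> sigma_sets UNIV {A \<in> sets Q. \<exists>k\<ge>1. \<forall>x y. q k x = q k y \<longrightarrow> (x \<in> A \<longleftrightarrow> y \<in> A)}"
  shows "cell_approximable Q q (indicator A)"
proof -
  interpret prob_space Q by fact
  define G where "G = {A \<in> sets Q. \<exists>k\<ge>1. \<forall>x y. q k x = q k y \<longrightarrow> (x \<in> A \<longleftrightarrow> y \<in> A)}"
  have stable: "Int_stable G"
    unfolding Int_stable_def
  proof (intro ballI)
    fix A B assume "A \<in> G" "B \<in> G"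
    then obtain k m where km: "1 \<le> k" "1 \<le> m" and A: "A \<in> sets Q" "\<And>x y. q k x = q k y \<Longrightarrow> (x \<in> A \<longleftrightarrow> y \<in> A)"
      and B: "B \<in> sets Q" "\<And>x y. q m x = q m y \<Longrightarrow> (x \<in> B \<longleftrightarrow> y \<in> B)"
      unfolding G_def by blast
    have "x \<in> A \<inter> B \<longleftrightarrow> y \<in> A \<inter> B" if eq: "q (max k m) x = q (max k m) y" for x y
    proof -
      have "q k x = q k y" by (rule refine[OF km(1) _ eq]) simp
      moreover have "q m x = q m y" by (rule refine[OF km(2) _ eq]) simp
      ultimately show ?thesis using A(2) B(2) by blast
    qed
    moreover have "1 \<le> max k m" using km by simp
    moreover have "A \<inter> B \<in> sets Q" using A(1) B(1) by simp
    ultimately show "A \<inter> B \<in> G" unfolding G_def by blast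
  qed
  have GQ: "G \<subseteq> sets Q" unfolding G_def by blast
  then have sQ: "C \<in> sets Q" if "C \<in> sigma_sets UNIV G" for C
    using that sets.sigma_sets_subset[OF GQ] space_Q by auto
  have "G \<subseteq> Pow UNIV" by simp
  moreover have "A \<in> sigma_sets UNIV G" using A unfolding G_def .
  ultimately show ?thesis
  proof (induction rule: sigma_sets_induct_disjoint[OF stable, consumes 2, case_names basic empty compl union])
    case (basic A)
    then obtain k where k: "1 \<le> k" and A_sets: "A \<in> sets Q"
      and A: "\<And>x y. q k x = q k y \<Longrightarrow> (x \<in> A \<longleftrightarrow> y \<in> A)"
      unfolding G_def by blast
    show ?case
    proof (rule cell_approximable_self[OF _ k])
      show "integrable Q (indicator A :: 'x \<Rightarrow> real)"
        using A_sets by (simp add: emeasure_eq_measure)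
      show "indicator A x = (indicator A y :: real)" if "q k x = q k y" for x y
        using A[OF that] by (simp add: indicator_def)
    qed
  next
    case empty
    show ?case by (rule cell_approximable_self[of Q _ 1]) auto
  next
    case (compl A)
    have one: "cell_approximable Q q (\<lambda>x. 1)" by (rule cell_approximable_self[of Q _ 1]) auto
    have "cell_approximable Q q (\<lambda>x. 1 + (- 1) * indicator A x)"
      by (rule cell_approximable_add[OF refine one cell_approximable_scale[OF compl.IH]])
    moreover have "(\<lambda>x. 1 + (- 1) * indicator A x) = (indicator (UNIV - A) :: 'x \<Rightarrow> real)"
      by (auto simp: indicator_def)
    ultimately show ?case by simp
  next
    case (union A)
    have A_sets [measurable]: "A i \<in> sets Q" for i using union.hyps sQ by blast
    have fin: "cell_approximable Q q (\<lambda>x. \<Sum>i<n. indicator (A i) x)" for n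
    proof (induction n)
      case 0
      show ?case by (rule cell_approximable_self[of Q _ 1]) auto
    next
      case (Suc n)
      show ?case
        unfolding sum.lessThan_Suc by (rule cell_approximable_add[OF refine Suc.IH union.IH])
    qed
    have int_U: "integrable Q (indicator (\<Union>i. A i) :: 'x \<Rightarrow> real)"
      by (rule integrable_const_bound[where B = 1]) auto
    show ?case
    proof (rule cell_approximable_L1_closed[OF int_U])
      fix \<epsilon> :: real assume e: "0 < \<epsilon>"
      have "(\<lambda>i. measure Q (A i)) sums measure Q (\<Union>i. A i)"
        using union.hyps by (intro finite_measure_UNION) auto
      then have "(\<lambda>n. \<Sum>i<n. measure Q (A i)) \<longlonglongrightarrow> measure Q (\<Union>i. A i)" by (simp add: sums_def)
      then obtain n where n: "\<bar>(\<Sum>i<n. measure Q (A i)) - measure Q (\<Union>i. A i)\<bar> < \<epsilon>"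
        using e unfolding lim_sequentially dist_real_def by blast
      have le: "(\<Sum>i<n. indicator (A i) x) \<le> (indicator (\<Union>i. A i) x :: real)" for x
      proof -
        have sums: "(\<lambda>i. indicator (A i) x :: real) sums indicator (\<Union>i. A i) x"
          using union.hyps(1) by (intro indicator_sums) (auto simp: disjoint_family_on_def)
        show ?thesis
          using sum_le_suminf[OF sums_summable[OF sums], of "{..<n}"] sums_unique[OF sums] by simp
      qed
      have "(\<integral>x. \<bar>(indicator (\<Union>i. A i) x :: real) - (\<Sum>i<n. indicator (A i) x)\<bar> \<partial>Q)
          = (\<integral>x. indicator (\<Union>i. A i) x - (\<Sum>i<n. indicator (A i) x) \<partial>Q)"
        by (rule Bochner_Integration.integral_cong[OF refl]) (rule abs_of_nonneg, simp only: diff_ge_0_iff_ge le)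
      also have "\<dots> = measure Q (\<Union>i. A i) - (\<Sum>i<n. measure Q (A i))"
        by (subst Bochner_Integration.integral_diff) (auto simp: space_Q Bochner_Integration.integral_sum emeasure_eq_measure)
      also have "\<dots> < \<epsilon>" using n by linarith
      finally show "\<exists>g'. cell_approximable Q q g' \<and> (\<integral>x. \<bar>indicator (\<Union>i. A i) x - g' x\<bar> \<partial>Q) < \<epsilon>"
        using fin by blast
    qed
  qed
qed

lemma cell_approximable_integrable:
  fixes q :: "nat \<Rightarrow> 'x \<Rightarrow> 'c"
  assumes Q: "prob_space Q" and space_Q: "space Q = UNIV" and sub: "subalgebra Q F"
    and refine: "\<And>k m x y. 1 \<le> k \<Longrightarrow> k \<le> m \<Longrightarrow> q m x = q m y \<Longrightarrow> q k x = q k y"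
    and gen: "sets F \<subseteq> sigma_sets UNIV {A \<in> sets Q. \<exists>k\<ge>1. \<forall>x y. q k x = q k y \<longrightarrow> (x \<in> A \<longleftrightarrow> y \<in> A)}"
    and g: "integrable Q g" "g \<in> borel_measurable F"
  shows "cell_approximable Q q g"
proof -
  have "integrable (restr_to_subalg Q F) g" by (rule integrable_in_subalg[OF sub g(2,1)])
  then show ?thesis
  proof (induction rule: integrable_induct)
    case (base A c)
    then have "A \<in> sets F" by (simp add: sets_restr_to_subalg[OF sub])
    then have "cell_approximable Q q (indicator A)"
      using gen by (intro cell_approximable_indicator[OF Q space_Q refine]) auto
    from cell_approximable_scale[OF this, of c] show ?case by (simp add: mult.commute)
  next
    case (add f g)
    show ?case by (rule cell_approximable_add[OF refine add.IH])
  next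
    case (lim f s)
    have f: "integrable Q f" by (rule integrable_from_subalg[OF sub lim.hyps(4)])
    have s: "integrable Q (s i)" for i by (rule integrable_from_subalg[OF sub lim.hyps(1)])
    show ?case
    proof (rule cell_approximable_L1_closed[OF f])
      fix \<epsilon> :: real assume e: "0 < \<epsilon>"
      have "(\<lambda>i. \<integral>x. \<bar>f x - s i x\<bar> \<partial>Q) \<longlonglongrightarrow> (\<integral>x. 0 \<partial>Q)"
      proof (rule integral_dominated_convergence[where w = "\<lambda>x. 3 * \<bar>f x\<bar>"])
        show "AE x in Q. (\<lambda>i. \<bar>f x - s i x\<bar>) \<longlonglongrightarrow> 0"
        proof (rule AE_I2)
          fix x
          have "(\<lambda>i. s i x) \<longlonglongrightarrow> f x"
            by (rule lim.hyps(2)) (simp add: space_restr_to_subalg space_Q)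
          then have "(\<lambda>i. \<bar>f x - s i x\<bar>) \<longlonglongrightarrow> \<bar>f x - f x\<bar>" by (intro tendsto_intros)
          then show "(\<lambda>i. \<bar>f x - s i x\<bar>) \<longlonglongrightarrow> 0" by simp
        qed
        show "AE x in Q. norm \<bar>f x - s i x\<bar> \<le> 3 * \<bar>f x\<bar>" for i
        proof (rule AE_I2)
          fix x
          have "\<bar>s i x\<bar> \<le> 2 * \<bar>f x\<bar>"
            using lim.hyps(3)[of x i] by (simp add: space_restr_to_subalg space_Q)
          then show "norm \<bar>f x - s i x\<bar> \<le> 3 * \<bar>f x\<bar>" by simp
        qed
      qed (use f s in auto)
      then have "(\<lambda>i. \<integral>x. \<bar>f x - s i x\<bar> \<partial>Q) \<longlonglongrightarrow> 0" by simp
      then have "eventually (\<lambda>i. (\<integral>x. \<bar>f x - s i x\<bar> \<partial>Q) < \<epsilon>) sequentially"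
        using e by (rule order_tendstoD)
      then obtain i where "(\<integral>x. \<bar>f x - s i x\<bar> \<partial>Q) < \<epsilon>"
        using eventually_happens trivial_limit_sequentially by blast
      then show "\<exists>g'. cell_approximable Q q g' \<and> (\<integral>x. \<bar>f x - g' x\<bar> \<partial>Q) < \<epsilon>"
        using lim.IH by blast
    qed
  qed
qed

section \<open>Path space and the quantised past of a path\<close>

definition time_shift :: "int \<Rightarrow> (int \<Rightarrow> 'a) \<Rightarrow> int \<Rightarrow> 'a" where
  "time_shift n x = (\<lambda>t. x (t + n))"

abbreviation paths :: "(int \<Rightarrow> 'a::topological_space) measure" where
  "paths \<equiv> \<Pi>\<^sub>M t\<in>UNIV. borel"

definition path_past :: "(int \<Rightarrow> 'a::topological_space) measure" where
  "path_past = vimage_algebra UNIV (\<lambda>x. \<lambda>t\<in>{..<0}. x t) (\<Pi>\<^sub>M t\<in>{..<0}. borel)"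

definition past_word :: "'a set set \<Rightarrow> nat \<Rightarrow> (int \<Rightarrow> 'a) \<Rightarrow> nat \<Rightarrow> 'a set" where
  "past_word \<A> l x = (\<lambda>i\<in>{1..l}. atom_of \<A> (x (- int i)))"

lemma time_shift_apply: "time_shift n x t = x (t + n)"
  by (simp add: time_shift_def)

lemma past_word_eq_iff:
  "past_word \<A> l x = past_word \<A> l y \<longleftrightarrow>
    (\<forall>i\<in>{1..l}. atom_of \<A> (x (- int i)) = atom_of \<A> (y (- int i)))"
  unfolding past_word_def restrict_def fun_eq_iff by auto

lemma atom_of_eq_iff:
  assumes "algebra UNIV \<A>" "finite \<A>"
  shows "atom_of \<A> x = atom_of \<A> y \<longleftrightarrow> (\<forall>D\<in>\<A>. x \<in> D \<longleftrightarrow> y \<in> D)" (is "?L \<longleftrightarrow> ?R")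
proof
  assume eq: ?L
  have "x \<in> atom_of \<A> y" "y \<in> atom_of \<A> x"
    using atom_of_in(2)[OF assms] eq by metis+
  then show ?R unfolding atom_of_def by blast
next
  assume ?R
  then have "{A \<in> \<A>. x \<in> A} = {A \<in> \<A>. y \<in> A}" by blast
  then show ?L unfolding atom_of_def by simp
qed

text \<open>A longer block quantised by a finer field determines the shorter and coarser one.\<close>

lemma past_word_refine:
  assumes \<A>: "algebra UNIV \<A>" "finite \<A>" and \<C>: "algebra UNIV \<C>" "finite \<C>"
    and "\<A> \<subseteq> \<C>" "l \<le> m" and eq: "past_word \<C> m x = past_word \<C> m y"
  shows "past_word \<A> l x = past_word \<A> l y"
  using eq assms(5,6) unfolding past_word_eq_iff atom_of_eq_iff[OF \<A>] atom_of_eq_iff[OF \<C>]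
  by fastforce

lemma space_paths: "space paths = UNIV"
  by (simp add: space_PiM)

lemma space_path_past: "space path_past = UNIV"
  by (simp add: path_past_def)

lemma restrict_past_measurable: "(\<lambda>x. \<lambda>t\<in>{..<0::int}. x t) \<in> measurable path_past (\<Pi>\<^sub>M t\<in>{..<0}. borel)"
  unfolding path_past_def by (rule measurable_vimage_algebra1) (auto simp: space_PiM)

lemma coordinate_past: "t < 0 \<Longrightarrow> (\<lambda>x. x t) \<in> measurable path_past borel"
  using measurable_compose[OF restrict_past_measurable measurable_component_singleton[of t "{..<0}"]] by simp

lemma measurable_into_path_past:
  assumes "f \<in> space N \<rightarrow> UNIV" "\<And>t. t < 0 \<Longrightarrow> (\<lambda>x. f x t) \<in> measurable N borel"
  shows "f \<in> measurable N path_past"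
  unfolding path_past_def
  by (rule measurable_vimage_algebra2[OF assms(1)], rule measurable_restrict, rule assms(2)) simp

lemma path_past_le: "sets path_past \<subseteq> sets paths"
  unfolding path_past_def
  by (rule sets_image_in_sets) (auto simp: space_PiM intro!: measurable_restrict)

lemma time_shift_measurable: "time_shift n \<in> measurable paths paths"
  unfolding time_shift_def by (rule measurable_PiM_single') (auto simp: space_PiM)

lemma finite_range_past_word:
  assumes "algebra UNIV \<A>" "finite \<A>"
  shows "finite (range (past_word \<A> l))"
proof (rule finite_subset)
  show "range (past_word \<A> l) \<subseteq> PiE {1..l} (\<lambda>_. \<A>)"
    using atom_of_in(1)[OF assms] by (auto simp: past_word_def)
qed (use assms in \<open>auto intro: finite_PiE\<close>)

lemma past_word_measurable:
  assumes \<A>: "algebra UNIV \<A>" "finite \<A>" "\<A> \<subseteq> sets borel"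
  shows "past_word \<A> l \<in> measurable path_past (count_space UNIV)"
proof -
  have "{x \<in> space path_past. \<forall>i\<in>{1..l}. \<forall>D\<in>\<A>. x (- int i) \<in> D \<longleftrightarrow> y (- int i) \<in> D} \<in> sets path_past" for y
  proof (intro sets.sets_Collect_finite_All)
    fix i D assume "i \<in> {1..l}" "D \<in> \<A>"
    then have "(\<lambda>x. x (- int i)) \<in> measurable path_past borel" "D \<in> sets borel"
      using \<A>(3) by (auto intro: coordinate_past)
    then have [measurable]: "Measurable.pred path_past (\<lambda>x. x (- int i) \<in> D)"
      by (rule pred_sets2[rotated])
    show "{x \<in> space path_past. x (- int i) \<in> D \<longleftrightarrow> y (- int i) \<in> D} \<in> sets path_past"
      by measurable
  qed (use \<A>(2) in auto)
  then have "past_word \<A> l -` {past_word \<A> l y} \<inter> space path_past \<in> sets path_past" for y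
    by (simp add: past_word_eq_iff atom_of_eq_iff[OF \<A>(1,2)] space_path_past vimage_def)
  then have q: "past_word \<A> l \<in> measurable path_past (count_space (range (past_word \<A> l)))"
    unfolding measurable_count_space_eq2[OF finite_range_past_word[OF \<A>(1,2)]] by auto
  have "(\<lambda>w. w) \<in> measurable (count_space (range (past_word \<A> l))) (count_space UNIV)" by simp
  from measurable_compose[OF q this] show ?thesis .
qed

lemma past_recurrence_paths:
  assumes Q: "prob_space Q" "sets Q = sets paths" "\<And>n. distr Q Q (time_shift n) = Q"
    and \<A>: "algebra UNIV \<A>" "finite \<A>" "\<A> \<subseteq> sets borel"
  shows "past_recurrence Q path_past time_shift (past_word \<A> l)"
proof -
  have space_Q: "space Q = UNIV" using sets_eq_imp_space_eq[OF Q(2)] by (simp add: space_paths)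
  show ?thesis
    unfolding past_recurrence_def past_recurrence_axioms_def
  proof (intro conjI allI)
    show "prob_space Q" by fact
    show "space Q = UNIV" by fact
    show "subalgebra Q path_past"
      using path_past_le space_Q Q(2) unfolding subalgebra_def by (simp add: space_path_past)
    show "time_shift 0 x = x" for x :: "int \<Rightarrow> 'a" by (simp add: time_shift_def)
    show "time_shift m (time_shift n x) = time_shift (m + n) x" for m n and x :: "int \<Rightarrow> 'a"
      by (simp add: time_shift_def add.assoc)
    show "time_shift n \<in> measurable Q Q" for n
      using time_shift_measurable[of n] by (simp only: measurable_cong_sets[OF Q(2) Q(2)])
    show "distr Q Q (time_shift n) = Q" for n by fact
    show "time_shift (- 1) \<in> measurable (path_past :: (int \<Rightarrow> 'a) measure) path_past"
      by (rule measurable_into_path_past) (auto simp: time_shift_def intro: coordinate_past)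
    show "past_word \<A> l \<in> measurable path_past (count_space UNIV)"
      by (rule past_word_measurable[OF \<A>])
    show "finite (range (past_word \<A> l))" by (rule finite_range_past_word[OF \<A>(1,2)])
  qed
qed

lemma recurrence_time_eq_return_time:
  assumes "past_recurrence Q path_past time_shift (past_word \<A> l)"
  shows "recurrence_time \<A> l x j = past_recurrence.return_time time_shift (past_word \<A> l) x j"
proof (induction j)
  case 0
  show ?case by (simp add: past_recurrence.return_time.simps[OF assms])
next
  case (Suc j)
  show ?case
    unfolding recurrence_time.simps past_recurrence.return_time.simps[OF assms] Suc past_word_eq_iff
    by (simp add: time_shift_apply)
qed

text \<open>It suffices to generate each coordinate \<open>x t\<close> with \<open>t < 0\<close>. The event that \<open>x t\<close> lies in \<open>D \<in> \<B> k\<close> is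
  decided by a quantised block as soon as its field contains \<open>D\<close> and its length reaches back to \<open>t\<close>.\<close>

lemma path_past_generated:
  fixes \<B> :: "nat \<Rightarrow> 'a::topological_space set set"
  assumes \<B>: "\<And>k. 1 \<le> k \<Longrightarrow> algebra UNIV (\<B> k)" "\<And>k. 1 \<le> k \<Longrightarrow> finite (\<B> k)"
      "\<And>k. 1 \<le> k \<Longrightarrow> \<B> k \<subseteq> sets borel" "mono_on {1..} \<B>"
      "sigma_sets UNIV (\<Union>k\<in>{1..}. \<B> k) = sets borel"
    and l: "mono_on {1..} l" "\<not> bdd_above (l ` {1..})"
  shows "sets path_past \<subseteq> sigma_sets UNIV {A \<in> sets paths. \<exists>k\<ge>1. \<forall>x y.
    past_word (\<B> k) (l k) x = past_word (\<B> k) (l k) y \<longrightarrow> (x \<in> A \<longleftrightarrow> y \<in> A)}"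
    (is "_ \<subseteq> sigma_sets UNIV ?G")
proof -
  define N where "N = sigma UNIV ?G"
  have N: "space N = UNIV" "sets N = sigma_sets UNIV ?G" unfolding N_def by auto
  have "(\<lambda>x. x t) \<in> measurable N borel" if t: "t < 0" for t :: int
  proof (rule measurable_sigma_sets[OF \<B>(5)[symmetric]])
    fix D assume "D \<in> (\<Union>k\<in>{1..}. \<B> k)"
    then obtain k where k: "1 \<le> k" "D \<in> \<B> k" by auto
    obtain m where m: "1 \<le> m" "nat (- t) < l m"
      using l(2) unfolding bdd_above_def by (metis (no_types, lifting) atLeast_iff imageE not_le)
    let ?n = "max k m"
    have n: "1 \<le> ?n" "k \<le> ?n" "m \<le> ?n" using k by auto
    have D: "D \<in> \<B> ?n" using monotone_onD[OF \<B>(4), of k ?n] k n by auto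
    have "l m \<le> l ?n" using monotone_onD[OF l(1), of m ?n] m n by auto
    then have t': "nat (- t) \<in> {1..l ?n}" "- int (nat (- t)) = t" using m t by auto
    have inv: "x t \<in> D \<longleftrightarrow> y t \<in> D"
      if "past_word (\<B> ?n) (l ?n) x = past_word (\<B> ?n) (l ?n) y" for x y
      using that t' D unfolding past_word_eq_iff atom_of_eq_iff[OF \<B>(1,2)[OF n(1)]] by metis
    have "D \<in> sets borel" using k \<B>(3) by blast
    then have "(\<lambda>x. x t) -` D \<inter> space paths \<in> sets paths"
      by (intro measurable_sets[OF measurable_component_singleton]) auto
    then have meas: "(\<lambda>x. x t) -` D \<in> sets paths" by (simp only: space_paths Int_UNIV_right)
    have "(\<lambda>x. x t) -` D \<in> ?G"
      by (intro CollectI conjI exI[of _ ?n] allI impI meas n(1), unfold vimage_eq, rule inv)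
    then show "(\<lambda>x. x t) -` D \<inter> space N \<in> sets N"
      unfolding N Int_UNIV_right by (rule sigma_sets.Basic)
  qed auto
  then have "sets path_past \<subseteq> sets N"
    unfolding path_past_def by (intro sets_image_in_sets N measurable_restrict) auto
  then show ?thesis unfolding N .
qed

text \<open>Every event of the past field of \<open>X\<close> is the preimage of an event of the past on the path space, so the
  integrals that characterise both conditional expectations agree.\<close>

lemma past_field_cond_exp:
  fixes X :: "int \<Rightarrow> 'w \<Rightarrow> 'a::topological_space"
  assumes M: "prob_space M" and X [measurable]: "\<And>t. X t \<in> borel_measurable M"
    and f: "integrable (distr M paths (\<lambda>\<omega> t. X t \<omega>)) (f :: _ \<Rightarrow> real)"
  shows "AE \<omega> in M. real_cond_exp M (past_field M X) (\<lambda>\<omega>. f (\<lambda>t. X t \<omega>)) \<omega> =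
    real_cond_exp (distr M paths (\<lambda>\<omega> t. X t \<omega>)) path_past f (\<lambda>t. X t \<omega>)"
proof -
  interpret prob_space M by fact
  define Y where "Y \<omega> = (\<lambda>t. X t \<omega>)" for \<omega>
  define Q where "Q = distr M paths Y"
  have Y [measurable]: "Y \<in> measurable M paths"
    unfolding Y_def by (rule measurable_PiM_single') (auto simp: space_PiM)
  have f: "integrable Q f" using f unfolding Q_def Y_def .
  interpret Q: prob_space Q unfolding Q_def by (rule prob_space_distr) (rule Y)
  have sub_Q: "subalgebra Q path_past"
    unfolding subalgebra_def Q_def using path_past_le by (simp add: space_path_past space_PiM)
  interpret Q: finite_measure_subalgebra Q path_past by unfold_locales (rule sub_Q)
  have restr: "(\<lambda>\<omega>. \<lambda>t\<in>{..<0}. X t \<omega>) \<in> measurable M (\<Pi>\<^sub>M t\<in>{..<0}. borel)"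
    by (rule measurable_restrict) (rule X)
  have sub: "subalgebra M (past_field M X)"
    unfolding subalgebra_def past_field_def using sets_image_in_sets[OF refl restr] by simp
  interpret finite_measure_subalgebra M "past_field M X" by unfold_locales (rule sub)
  have Y_past: "Y \<in> measurable (past_field M X) path_past"
  proof (rule measurable_into_path_past)
    fix t :: int assume t: "t < 0"
    have "(\<lambda>\<omega>. \<lambda>t\<in>{..<0}. X t \<omega>) \<in> measurable (past_field M X) (\<Pi>\<^sub>M t\<in>{..<0}. borel)"
      unfolding past_field_def by (rule measurable_vimage_algebra1) (auto simp: space_PiM)
    from measurable_compose[OF this measurable_component_singleton[of t]] t
    show "(\<lambda>\<omega>. Y \<omega> t) \<in> borel_measurable (past_field M X)" by (simp add: Y_def)
  qed simp
  let ?g = "real_cond_exp Q path_past f"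
  have g: "integrable Q ?g" by (rule Q.real_cond_exp_int(1)[OF f])
  have "AE \<omega> in M. real_cond_exp M (past_field M X) (\<lambda>\<omega>. f (Y \<omega>)) \<omega> = ?g (Y \<omega>)"
  proof (rule real_cond_exp_charact)
    show "integrable M (\<lambda>\<omega>. f (Y \<omega>))" "integrable M (\<lambda>\<omega>. ?g (Y \<omega>))"
      using f g integrable_distr[OF Y] unfolding Q_def by blast+
    show "(\<lambda>\<omega>. ?g (Y \<omega>)) \<in> borel_measurable (past_field M X)"
      by (rule measurable_compose[OF Y_past]) simp
    fix A assume "A \<in> sets (past_field M X)"
    moreover have dom: "(\<lambda>\<omega>. \<lambda>t\<in>{..<0}. X t \<omega>) \<in> space M \<rightarrow> space (\<Pi>\<^sub>M t\<in>{..<0::int}. borel :: 'a measure)"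
      by (auto simp: space_PiM)
    ultimately obtain C where C: "C \<in> sets (\<Pi>\<^sub>M t\<in>{..<0::int}. borel :: 'a measure)"
      and A: "A = (\<lambda>\<omega>. \<lambda>t\<in>{..<0}. X t \<omega>) -` C \<inter> space M"
      unfolding past_field_def sets_vimage_algebra2[OF dom] by blast
    define A' where "A' = (\<lambda>x. \<lambda>t\<in>{..<0}. x t) -` C \<inter> space (path_past :: (int \<Rightarrow> 'a) measure)"
    have A': "A' \<in> sets path_past"
      unfolding A'_def by (rule measurable_sets[OF restrict_past_measurable C])
    have A'_Q: "A' \<in> sets Q" using A' sub_Q unfolding subalgebra_def by blast
    have ind: "indicator A \<omega> = (indicator A' (Y \<omega>) :: real)" if "\<omega> \<in> space M" for \<omega>
      using that unfolding A A'_def Y_def by (simp add: indicator_def space_path_past)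
    have transfer: "(\<integral>\<omega>\<in>A. u (Y \<omega>) \<partial>M) = (\<integral>x\<in>A'. u x \<partial>Q)" if u: "integrable Q u" for u :: "_ \<Rightarrow> real"
    proof -
      have "(\<lambda>x. indicator A' x *\<^sub>R u x) \<in> borel_measurable Q"
        using A'_Q u by measurable
      then have m: "(\<lambda>x. indicator A' x *\<^sub>R u x) \<in> borel_measurable paths"
        unfolding Q_def by simp
      have "(\<integral>x\<in>A'. u x \<partial>Q) = (\<integral>\<omega>. indicator A' (Y \<omega>) *\<^sub>R u (Y \<omega>) \<partial>M)"
        unfolding set_lebesgue_integral_def Q_def by (rule integral_distr[OF Y m])
      also have "\<dots> = (\<integral>\<omega>\<in>A. u (Y \<omega>) \<partial>M)"
        unfolding set_lebesgue_integral_def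
        by (rule Bochner_Integration.integral_cong) (simp_all add: ind)
      finally show ?thesis by simp
    qed
    show "(\<integral>\<omega>\<in>A. f (Y \<omega>) \<partial>M) = (\<integral>\<omega>\<in>A. ?g (Y \<omega>) \<partial>M)"
      unfolding transfer[OF f] transfer[OF g] by (rule Q.real_cond_exp_intA[OF f A'])
  qed
  then show ?thesis unfolding Y_def Q_def .
qed

section \<open>Convergence of the empirical conditional distributions\<close>

lemma mono_on_unbounded_filterlim:
  fixes J :: "nat \<Rightarrow> nat"
  assumes "mono_on {1..} J" "\<not> bdd_above (J ` {1..})"
  shows "filterlim J at_top sequentially"
  unfolding filterlim_at_top eventually_sequentially
proof
  fix Z
  obtain m where m: "1 \<le> m" "Z < J m"
    using assms(2) unfolding bdd_above_def by (metis (no_types, lifting) atLeast_iff imageE not_le)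
  have "Z \<le> J n" if "m \<le> n" for n
    using monotone_onD[OF assms(1), of m n] m that by auto
  then show "\<exists>N. \<forall>n\<ge>N. Z \<le> J n" by blast
qed

theorem mainTheorem1:
  fixes M :: "'w measure"
    and X :: "int \<Rightarrow> 'w \<Rightarrow> 'a::polish_space"
    and \<B> :: "nat \<Rightarrow> 'a set set"
    and l J :: "nat \<Rightarrow> nat"
    and B :: "'a set"
  assumes "prob_space M"
    and "stationary_process M X"
    and "\<And>k. 1 \<le> k \<Longrightarrow> algebra UNIV (\<B> k)"
    and "\<And>k. 1 \<le> k \<Longrightarrow> finite (\<B> k)"
    and "\<And>k. 1 \<le> k \<Longrightarrow> \<B> k \<subseteq> sets borel"
    and "mono_on {1..} \<B>"
    and "sigma_sets UNIV (\<Union>k\<in>{1..}. \<B> k) = sets borel"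
    and "\<And>k. 1 \<le> k \<Longrightarrow> 0 < l k"
    and "mono_on {1..} l"
    and "\<not> bdd_above (l ` {1..})"
    and "\<And>k. 1 \<le> k \<Longrightarrow> 0 < J k"
    and "mono_on {1..} J"
    and "\<not> bdd_above (J ` {1..})"
    and "B \<in> (\<Union>k\<in>{1..}. \<B> k)"
  shows "converges_in_L1 M
           (\<lambda>k \<omega>. measure (empirical_cond_dist (\<B> k) (l k) (J k) (\<lambda>t. X t \<omega>)) B)
           (real_cond_exp M (past_field M X) (\<lambda>\<omega>. indicator B (X 0 \<omega>)))"
proof -
  note \<B> = assms(3-7)
  interpret M: prob_space M by fact
  have X [measurable]: "X t \<in> borel_measurable M" for t
    using assms(2) unfolding stationary_process_def by blast
  define Y where "Y \<omega> = (\<lambda>t. X t \<omega>)" for \<omega>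
  define Q where "Q = distr M paths Y"
  have Y [measurable]: "Y \<in> measurable M paths"
    unfolding Y_def by (rule measurable_PiM_single') (auto simp: space_PiM)
  have Q: "prob_space Q" unfolding Q_def by (rule M.prob_space_distr) (rule Y)
  have sets_Q: "sets Q = sets paths" unfolding Q_def by simp
  have space_Q: "space Q = UNIV" unfolding Q_def by (simp add: space_PiM)
  have Q_shift: "distr Q Q (time_shift n) = Q" for n
  proof -
    have "distr Q Q (time_shift n) = distr Q paths (time_shift n)"
      by (rule distr_cong) (simp_all add: sets_Q)
    also have "\<dots> = distr M paths (time_shift n \<circ> Y)"
      unfolding Q_def by (rule distr_distr[OF time_shift_measurable Y])
    also have "time_shift n \<circ> Y = (\<lambda>\<omega> t. X (t + n) \<omega>)"
      by (auto simp: time_shift_def Y_def)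
    also have "distr M paths (\<lambda>\<omega> t. X (t + n) \<omega>) = Q"
      using assms(2) unfolding stationary_process_def Q_def Y_def by blast
    finally show ?thesis .
  qed
  interpret Q: prob_space Q by (rule Q)
  obtain b where "1 \<le> b" "B \<in> \<B> b" using assms(14) by auto
  then have B: "B \<in> sets borel" using \<B>(3) by blast
  define f :: "(int \<Rightarrow> 'a) \<Rightarrow> real" where "f x = indicator B (x 0)" for x
  have f_paths: "f \<in> borel_measurable paths"
    unfolding f_def using B by (intro measurable_compose[OF measurable_component_singleton]) auto
  have f [measurable]: "f \<in> borel_measurable Q"
    using f_paths by (simp only: measurable_cong_sets[OF sets_Q refl])
  have f_past: "(\<lambda>x. f (time_shift (- 1) x)) \<in> borel_measurable path_past"
    unfolding f_def time_shift_def using B by (intro measurable_compose[OF coordinate_past]) auto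
  have f_bound: "\<bar>f x\<bar> \<le> 1" for x unfolding f_def by (simp add: indicator_def)
  have int_f: "integrable Q f" using f_bound by (intro Q.integrable_const_bound[where B = 1]) auto
  define w where "w k = past_word (\<B> k) (l k)" for k
  have rec: "past_recurrence Q path_past time_shift (w k)" if "1 \<le> k" for k
    unfolding w_def by (rule past_recurrence_paths[OF Q sets_Q Q_shift]) (use \<B> that in auto)
  have sub: "subalgebra Q path_past"
    using past_recurrence.subalgebra[OF rec[of 1]] by simp
  interpret Q: finite_measure_subalgebra Q path_past by unfold_locales (rule sub)
  define g where "g = real_cond_exp Q path_past f"
  have int_g: "integrable Q g" unfolding g_def by (rule Q.real_cond_exp_int(1)[OF int_f])
  have refine: "w k x = w k y" if "1 \<le> k" "k \<le> m" "w m x = w m y" for k m x y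
  proof -
    have "\<B> k \<subseteq> \<B> m" "l k \<le> l m"
      using monotone_onD[OF \<B>(4), of k m] monotone_onD[OF assms(9), of k m] that by auto
    then show ?thesis
      using past_word_refine[of "\<B> k" "\<B> m" "l k" "l m" x y] \<B>(1,2) that unfolding w_def by auto
  qed
  have approx: "cell_approximable Q w g"
  proof (rule cell_approximable_integrable[OF Q space_Q sub refine _ int_g])
    show "sets path_past \<subseteq> sigma_sets UNIV {A \<in> sets Q. \<exists>k\<ge>1. \<forall>x y. w k x = w k y \<longrightarrow> (x \<in> A \<longleftrightarrow> y \<in> A)}"
      unfolding sets_Q w_def by (rule path_past_generated[OF \<B> assms(9,10)])
    show "g \<in> borel_measurable path_past" unfolding g_def by simp
  qed
  define a where "a k x = measure (empirical_cond_dist (\<B> k) (l k) (J k) x) B" for k x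
  have a_eq: "a k x = 1 / real (J k) * (\<Sum>j=1..J k. f (time_shift (- int (past_recurrence.return_time time_shift (w k) x j)) x))"
    if "1 \<le> k" for k x
    using measure_empirical_cond_dist[OF B assms(11)[OF that]]
      recurrence_time_eq_return_time[OF rec[OF that, unfolded w_def]]
    unfolding a_def w_def f_def time_shift_def by simp
  have a_meas: "a k \<in> borel_measurable Q" if "1 \<le> k" for k
    using past_recurrence.recurrence_average_measurable[OF rec[OF that] f, of "J k"] a_eq[OF that]
    by (simp cong: measurable_cong)
  have a_bound: "\<bar>a k x\<bar> \<le> 1" if k: "1 \<le> k" for k x
  proof -
    have "\<bar>\<Sum>j=1..J k. f (time_shift (- int (past_recurrence.return_time time_shift (w k) x j)) x)\<bar> \<le> (\<Sum>j=1..J k. 1)"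
      by (rule order_trans[OF sum_abs sum_mono]) (rule f_bound)
    then show ?thesis using assms(11)[OF k] unfolding a_eq[OF k] by (simp add: abs_mult field_simps)
  qed
  have int_a: "integrable Q (a k)" if "1 \<le> k" for k
    using a_bound[OF that] a_meas[OF that] by (intro Q.integrable_const_bound[where B = 1]) auto
  have bound: "(\<integral>x. \<bar>a k x - g x\<bar> \<partial>Q) \<le> 2 / sqrt (real (J k)) + 2 * (\<integral>x. \<bar>g x - h x\<bar> \<partial>Q)"
    if "1 \<le> k" "integrable Q h" "\<And>x y. w k x = w k y \<Longrightarrow> h x = h y" for k h
    using past_recurrence.recurrence_average_L1_bound[OF rec[OF that(1)] f f_past f_bound that(2,3) assms(11)[OF that(1)]]
    unfolding a_eq[OF that(1)] g_def .
  have J: "filterlim J at_top sequentially" by (rule mono_on_unbounded_filterlim[OF assms(12,13)])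
  have "(\<lambda>n::nat. 2 / sqrt (real n)) \<longlonglongrightarrow> 0" by real_asymp
  then have J0: "(\<lambda>k. 2 / sqrt (real (J k))) \<longlonglongrightarrow> 0" using J by (rule filterlim_compose)
  have lim_Q: "(\<lambda>k. \<integral>x. \<bar>a k x - g x\<bar> \<partial>Q) \<longlonglongrightarrow> 0"
  proof (rule order_tendstoI)
    fix y :: real assume "y < 0"
    moreover have "0 \<le> (\<integral>x. \<bar>a k x - g x\<bar> \<partial>Q)" for k by simp
    ultimately show "\<forall>\<^sub>F k in sequentially. y < (\<integral>x. \<bar>a k x - g x\<bar> \<partial>Q)"
      by (intro always_eventually allI) (rule less_le_trans)
  next
    fix \<epsilon> :: real assume e: "0 < \<epsilon>"
    then have e4: "0 < \<epsilon> / 4" by simp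
    obtain m h where m: "1 \<le> m" and h: "integrable Q h" "\<forall>x y. w m x = w m y \<longrightarrow> h x = h y"
      "(\<integral>x. \<bar>g x - h x\<bar> \<partial>Q) < \<epsilon> / 4"
      using approx e4 unfolding cell_approximable_def by meson
    have "\<forall>\<^sub>F k in sequentially. 2 / sqrt (real (J k)) < \<epsilon> / 2"
      using e by (intro order_tendstoD(2)[OF J0]) simp
    moreover have "\<forall>\<^sub>F k in sequentially. m \<le> k" by (rule eventually_ge_at_top)
    ultimately show "\<forall>\<^sub>F k in sequentially. (\<integral>x. \<bar>a k x - g x\<bar> \<partial>Q) < \<epsilon>"
    proof eventually_elim
      case (elim k)
      have inv: "h x = h y" if "w k x = w k y" for x y
        using refine[OF m elim(2) that] h(2) by blast
      have "(\<integral>x. \<bar>a k x - g x\<bar> \<partial>Q) \<le> 2 / sqrt (real (J k)) + 2 * (\<integral>x. \<bar>g x - h x\<bar> \<partial>Q)"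
        by (rule bound[OF order_trans[OF m elim(2)] h(1) inv])
      with elim(1) h(3) show ?case by linarith
    qed
  qed
  define g' where "g' = real_cond_exp M (past_field M X) (\<lambda>\<omega>. indicator B (X 0 \<omega>))"
  have g'_eq: "AE \<omega> in M. g' \<omega> = g (Y \<omega>)"
    using past_field_cond_exp[OF assms(1) X int_f[unfolded Q_def Y_def]]
    unfolding g'_def g_def Q_def Y_def f_def .
  have g_Y: "integrable M (\<lambda>\<omega>. g (Y \<omega>))"
    using integrable_distr[OF Y] int_g unfolding Q_def by blast
  have g'_meas: "g' \<in> borel_measurable M" unfolding g'_def by simp
  have int_g': "integrable M g'"
    using g_Y g'_eq g'_meas by (subst integrable_cong_AE[of _ _ "\<lambda>\<omega>. g (Y \<omega>)"]) auto
  have int_aY: "integrable M (\<lambda>\<omega>. a k (Y \<omega>))" if "1 \<le> k" for k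
    using integrable_distr[OF Y] int_a[OF that] unfolding Q_def by blast
  have dist_eq: "(\<integral>\<omega>. \<bar>a k (Y \<omega>) - g' \<omega>\<bar> \<partial>M) = (\<integral>x. \<bar>a k x - g x\<bar> \<partial>Q)" if k: "1 \<le> k" for k
  proof -
    have "(\<integral>\<omega>. \<bar>a k (Y \<omega>) - g' \<omega>\<bar> \<partial>M) = (\<integral>\<omega>. \<bar>a k (Y \<omega>) - g (Y \<omega>)\<bar> \<partial>M)"
      using int_aY[OF k] g_Y g'_meas g'_eq by (intro integral_cong_AE) auto
    also have "\<dots> = (\<integral>x. \<bar>a k x - g x\<bar> \<partial>Q)"
      unfolding Q_def
      by (rule integral_distr[OF Y, symmetric])
        (use int_a[OF k] int_g in \<open>auto simp: Q_def dest!: borel_measurable_integrable\<close>)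
    finally show ?thesis .
  qed
  have "(\<lambda>k. \<integral>\<omega>. \<bar>a k (Y \<omega>) - g' \<omega>\<bar> \<partial>M) \<longlonglongrightarrow> 0"
    by (rule Lim_transform_eventually[OF lim_Q])
      (auto simp: eventually_sequentially dist_eq intro!: exI[of _ 1])
  with int_aY int_g' have "converges_in_L1 M (\<lambda>k \<omega>. a k (Y \<omega>)) g'"
    unfolding converges_in_L1_def by blast
  then show ?thesis unfolding a_def Y_def g'_def .
qed

end
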